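(* Let $\boldsymbol{\beta}=(\beta_1,\dots,\beta_p)$ be an alternate base with Property (F) such that $\delta=\prod_{i=1}^p\beta_i$ is a Pisot unit. Then for every $i=1,\dots,p$ the shifted base $\boldsymbol{\beta}^{(i)}=(\beta_i,\beta_{i+1},\dots,\beta_{i+p-1})$ (indices modulo $p$) has Property (PP).
   Context: An alternate base is a $p$-tuple $\boldsymbol{\beta}=(\beta_1,\dots,\beta_p)$ of reals $\beta_i>1$, identified with the purely periodic sequence $(\beta_k)_{k\ge1}$, $\beta_{k+p}=\beta_k$. For $x\in[0,1)$ the $\boldsymbol{\beta}$-expansion $d_{\boldsymbol{\beta}}(x)=a_1a_2\cdots$ is given by the greedy algorithm $r_0=x$, $a_{k+1}=\lfloor\beta_{k+1}r_k\rfloor$, $r_{k+1}=\beta_{k+1}r_k-a_{k+1}$. $\mathrm{Fin}(\boldsymbol{\beta})$ is the set of $x\in[0,1)$ whose $\boldsymbol{\beta}$-expansion has only finitely many nonzero digits. $\boldsymbol{\beta}$ has Property (F) if for all $x,y\in\mathrm{Fin}(\boldsymbol{\beta})$: $x+y\in[0,1)$ implies $x+y\in\mathrm{Fin}(\boldsymbol{\beta})$, and $x-y\in[0,1)$ implies $x-y\in\mathrm{Fin}(\boldsymbol{\beta})$. $\boldsymbol{\beta}$ has Property (PP) if there exists $\gamma>0$ such that $d_{\boldsymbol{\beta}}(x)$ is purely periodic for every rational $x\in[0,\gamma)$. A Pisot unit is an algebraic unit $\delta>1$ all of whose other conjugates have modulus $<1$. *)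

theory Defs
  imports Complex_Main "HOL-Computational_Algebra.Polynomial" "HOL-Computational_Algebra.Factorial_Ring"
begin

text \<open>An alternate base of length p is represented 0-indexed as a function
  b :: nat => real with b k = beta_(k+1), all > 1, and p-periodic.\<close>
definition alt_base :: "nat \<Rightarrow> (nat \<Rightarrow> real) \<Rightarrow> bool" where
  "alt_base p b \<longleftrightarrow> p \<ge> 1 \<and> (\<forall>k. b k > 1) \<and> (\<forall>k. b (k + p) = b k)"

fun beta_rem :: "(nat \<Rightarrow> real) \<Rightarrow> real \<Rightarrow> nat \<Rightarrow> real" where
  "beta_rem b x 0 = x"
| "beta_rem b x (Suc k) = b k * beta_rem b x k - of_int \<lfloor>b k * beta_rem b x k\<rfloor>"

definition beta_digit :: "(nat \<Rightarrow> real) \<Rightarrow> real \<Rightarrow> nat \<Rightarrow> int" where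
  "beta_digit b x k = \<lfloor>b k * beta_rem b x k\<rfloor>"

definition Fin :: "(nat \<Rightarrow> real) \<Rightarrow> real set" where
  "Fin b = {x. 0 \<le> x \<and> x < 1 \<and> (\<exists>N. \<forall>k\<ge>N. beta_digit b x k = 0)}"

definition property_F :: "(nat \<Rightarrow> real) \<Rightarrow> bool" where
  "property_F b \<longleftrightarrow> (\<forall>x\<in>Fin b. \<forall>y\<in>Fin b.
      (0 \<le> x + y \<and> x + y < 1 \<longrightarrow> x + y \<in> Fin b) \<and>
      (0 \<le> x - y \<and> x - y < 1 \<longrightarrow> x - y \<in> Fin b))"

definition purely_periodic :: "(nat \<Rightarrow> int) \<Rightarrow> bool" where
  "purely_periodic a \<longleftrightarrow> (\<exists>n>0. \<forall>k. a (k + n) = a k)"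

definition property_PP :: "(nat \<Rightarrow> real) \<Rightarrow> bool" where
  "property_PP b \<longleftrightarrow> (\<exists>\<gamma>>0. \<forall>x\<in>\<rat>. 0 \<le> x \<and> x < \<gamma> \<longrightarrow> purely_periodic (beta_digit b x))"

definition pisot_unit :: "real \<Rightarrow> bool" where
  "pisot_unit \<delta> \<longleftrightarrow> \<delta> > 1 \<and> (\<exists>q :: int poly. lead_coeff q = 1 \<and> irreducible q \<and>
      poly (map_poly of_int q) \<delta> = 0 \<and> (coeff q 0 = 1 \<or> coeff q 0 = -1) \<and>
      (\<forall>z::complex. poly (map_poly of_int q) z = 0 \<and> z \<noteq> complex_of_real \<delta> \<longrightarrow> cmod z < 1))"

end

theory Submission
  imports Defs "HOL-Computational_Algebra.Polynomial_Factorial"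
    "HOL-Computational_Algebra.Fundamental_Theorem_Algebra"
begin

text \<open>
  Property (F) passes to shifts, so it suffices to treat the base itself. By (F), \<open>Fin b\<close> consists of
  all elements of \<open>[0,1)\<close> in the module spanned over the integers by the inverse partial products,
  and this in turn forces the base into the field of \<open>\<delta>\<close>.

  Let \<open>x\<close> be a small rational. Since \<open>\<delta>\<close> is a unit, its denominator divides \<open>\<delta> ^ n - 1\<close> for some \<open>n\<close>,
  so \<open>y = x - x / \<delta> ^ n\<close> has a finite expansion. The remainder of \<open>y / \<delta> ^ T\<close> after \<open>n\<close> periods has
  bounded conjugates (they are contracted by the Pisot property, and those of \<open>x\<close> are small), hence
  lies in a finite set independent of \<open>x\<close>. So for a suitable \<open>T\<close> the expansion of every such remainder
  ends within \<open>T\<close> periods, which says that the expansion of \<open>y\<close> ends within \<open>n\<close> periods. The same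
  finiteness keeps the remainders of \<open>y\<close> far enough from \<open>1\<close> to make the repetition of this block
  the greedy expansion of \<open>x = y + x / \<delta> ^ n\<close>.
\<close>

subsection \<open>Integer polynomials and their values at algebraic units\<close>

abbreviation ipoly :: "int poly \<Rightarrow> 'a::comm_ring_1 \<Rightarrow> 'a" where
  "ipoly P x \<equiv> poly (map_poly of_int P) x"

lemma ipoly_0: "ipoly 0 x = 0"
  by simp

lemma ipoly_1: "ipoly 1 x = 1"
  by simp

lemma ipoly_pCons: "ipoly (pCons a P) x = of_int a + x * ipoly P x"
  by (cases "a = 0 \<and> P = 0") (auto simp: map_poly_pCons)

lemma ipoly_add: "ipoly (P + Q) x = ipoly P x + ipoly Q x"
proof -
  have "map_poly of_int (P + Q) = (map_poly of_int P + map_poly of_int Q :: 'a poly)"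
    by (intro poly_eqI) (simp add: coeff_map_poly)
  then show ?thesis by simp
qed

lemma ipoly_smult: "ipoly (smult c P) x = of_int c * ipoly P x"
proof -
  have "map_poly of_int (smult c P) = (smult (of_int c) (map_poly of_int P) :: 'a poly)"
    by (intro poly_eqI) (simp add: coeff_map_poly)
  then show ?thesis by simp
qed

lemma ipoly_uminus: "ipoly (- P) x = - ipoly P x"
  using ipoly_smult[of "-1" P x] by simp

lemma ipoly_diff: "ipoly (P - Q) x = ipoly P x - ipoly Q x"
  using ipoly_add[of P "- Q" x] by (simp add: ipoly_uminus)

lemma ipoly_mult: "ipoly (P * Q) x = ipoly P x * ipoly Q x"
  by (induction P) (simp_all add: ipoly_pCons ipoly_add ipoly_smult algebra_simps)

lemma ipoly_power: "ipoly (P ^ n) x = ipoly P x ^ n"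
  by (induction n) (simp_all add: ipoly_mult)

lemma ipoly_sum: "ipoly (\<Sum>i\<in>A. P i) x = (\<Sum>i\<in>A. ipoly (P i) x)"
  by (induction A rule: infinite_finite_induct) (simp_all add: ipoly_add)

lemma ipoly_X: "ipoly [:0, 1:] x = x"
  by (simp add: ipoly_pCons)

lemma ipoly_of_int: "ipoly [:c:] x = of_int c"
  by (simp add: ipoly_pCons)

lemmas ipoly_simps = ipoly_0 ipoly_1 ipoly_add ipoly_diff ipoly_uminus ipoly_mult ipoly_power
  ipoly_smult ipoly_sum ipoly_X ipoly_of_int

lemma ipoly_of_real: "ipoly P (complex_of_real x) = complex_of_real (ipoly P x)"
  by (induction P) (simp_all add: ipoly_pCons)

lemma degree_map_poly_of_int:
  "degree (map_poly of_int P :: 'a::{comm_ring_1, ring_char_0} poly) = degree P"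
  by (rule degree_map_poly) simp

lemma pderiv_map_poly_of_int:
  "pderiv (map_poly of_int P) = (map_poly of_int (pderiv P) :: 'a::idom poly)"
  by (intro poly_eqI) (simp add: coeff_pderiv coeff_map_poly)

text \<open>Pseudo-division scales \<open>P\<close> by a power of the leading coefficient of
  \<open>q\<close>; as this is 1, the quotient and remainder keep integer coefficients.\<close>

lemma monic_division:
  fixes P q :: "int poly"
  assumes "lead_coeff q = 1" "degree q > 0"
  obtains S R where "P = q * S + R" "degree R < degree q"
proof -
  obtain S R where SR: "pseudo_divmod P q = (S, R)" by force
  have "q \<noteq> 0" using assms(1) by auto
  from pseudo_divmod[OF this SR] have "P = q * S + R" "R = 0 \<or> degree R < degree q"
    using assms(1) by auto
  then show thesis using that[of S R] assms(2) by auto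
qed

text \<open>A common root of \<open>q\<close> and \<open>pderiv q\<close> would be a root of a nonzero integer polynomial of
  minimal degree below that of \<open>q\<close>, and such a polynomial divides a multiple of the prime \<open>q\<close>.\<close>

lemma irreducible_int_poly_rsquarefree:
  fixes q :: "int poly"
  assumes irr: "irreducible q" and deg: "degree q > 0"
  shows "rsquarefree (map_poly of_int q :: complex poly)"
proof -
  have "ipoly (pderiv q) z \<noteq> 0" if qz: "ipoly q z = 0" for z :: complex
  proof
    assume dz: "ipoly (pderiv q) z = 0"
    have prime: "prime_elem q" using irr by (rule irreducible_imp_prime_poly)
    define A where "A = {m :: int poly. m \<noteq> 0 \<and> ipoly m z = 0}"
    have dA: "pderiv q \<in> A"
      using dz deg by (auto simp: A_def pderiv_eq_0_iff)
    obtain m where m: "m \<in> A" and least: "\<And>m'. m' \<in> A \<Longrightarrow> degree m \<le> degree m'"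
      using arg_min_nat_lemma[of "\<lambda>x. x \<in> A" _ degree, OF dA] by blast
    have dm: "degree m < degree q"
      using least[OF dA] deg degree_pderiv[of q] by simp
    obtain S R where SR: "pseudo_divmod q m = (S, R)" by force
    define c where "c = lead_coeff m ^ (Suc (degree q) - degree m)"
    have m0: "m \<noteq> 0" and mz: "ipoly m z = 0" using m by (auto simp: A_def)
    have c0: "c \<noteq> 0" using m0 by (simp add: c_def)
    from pseudo_divmod[OF m0 SR] have eq: "smult c q = m * S + R" and R: "R = 0 \<or> degree R < degree m"
      by (auto simp: c_def)
    have "ipoly R z = 0"
      using arg_cong[OF eq, of "\<lambda>p. ipoly p z"] qz mz by (simp add: ipoly_simps)
    then have "R = 0" using R least[of R] by (force simp: A_def)
    then have eq: "smult c q = m * S" using eq by simp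
    then have "q dvd m * S" by (metis dvd_smult dvd_refl)
    then consider "q dvd m" | "q dvd S" using prime by (auto simp: prime_elem_dvd_mult_iff)
    then show False
    proof cases
      case 1
      then show False using dvd_imp_degree_le[OF 1 m0] dm by simp
    next
      case 2
      \<comment> \<open>Cancelling \<open>q\<close> makes \<open>m\<close> a divisor of the nonzero
        constant \<open>c\<close>, hence itself a nonzero constant, which cannot vanish at
        \<open>z\<close>.\<close>
      then obtain S' where "S = q * S'" by blast
      with eq have "q * [:c:] = q * (m * S')" by (simp add: algebra_simps)
      then have cm: "[:c:] = m * S'" using deg mult_left_cancel[of q "[:c:]"] by force
      then have "S' \<noteq> 0" using c0 by auto
      then have "degree m = 0" using arg_cong[OF cm, of degree] m0 by (simp add: degree_mult_eq)
      then obtain a where "m = [:a:]" by (auto elim: degree_eq_zeroE)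
      then show False using m0 mz by (simp add: ipoly_simps)
    qed
  qed
  then show ?thesis by (auto simp: rsquarefree_roots pderiv_map_poly_of_int)
qed

lemma rsquarefree_card_roots:
  fixes q :: "complex poly"
  assumes "rsquarefree q"
  shows "card {z. poly q z = 0} = degree q"
proof -
  have "q \<noteq> 0" using assms by (auto simp: rsquarefree_def)
  have "degree q = degree (smult (lead_coeff q) (\<Prod>z | poly q z = 0. [:-z, 1:]))"
    using complex_poly_decompose_rsquarefree[OF assms] by simp
  also have "\<dots> = degree (\<Prod>z | poly q z = 0. [:-z, 1:])"
    using \<open>q \<noteq> 0\<close> by simp
  also have "\<dots> = (\<Sum>z | poly q z = 0. degree [:-z, 1:])"
    by (intro degree_prod_eq_sum_degree) auto
  finally show ?thesis by simp
qed

section \<open>Integer polynomials bounded at the roots of a fixed polynomial\<close>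

lemma finite_int_polys_bounded_coeffs:
  "finite {P :: int poly. degree P < d \<and> (\<forall>i. \<bar>coeff P i\<bar> \<le> N)}" (is "finite ?A")
proof (rule finite_subset)
  show "?A \<subseteq> Poly ` {xs. set xs \<subseteq> {-N..N} \<and> length xs = d}"
  proof
    fix P assume P: "P \<in> ?A"
    have "P = Poly (map (coeff P) [0..<d])"
      using P by (intro poly_eqI) (auto simp: nth_default_def coeff_eq_0)
    moreover have "set (map (coeff P) [0..<d]) \<subseteq> {-N..N}"
      using P by (auto simp: abs_le_iff minus_le_iff)
    ultimately show "P \<in> Poly ` {xs. set xs \<subseteq> {-N..N} \<and> length xs = d}"
      by (intro image_eqI) auto
  qed
  show "finite (Poly ` {xs. set xs \<subseteq> {-N..N} \<and> length xs = d})"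
    by (intro finite_imageI finite_lists_length_eq) auto
qed

text \<open>By Lagrange interpolation the coefficients are bounded in terms of the values at the roots
  of \<open>q\<close>.\<close>

lemma finite_int_polys_bounded_at_roots:
  fixes q :: "int poly"
  assumes irr: "irreducible q" and deg: "degree q > 0"
  shows "finite {P :: int poly. degree P < degree q \<and>
           (\<forall>z::complex. ipoly q z = 0 \<longrightarrow> cmod (ipoly P z) \<le> C)}"
proof -
  define Z where "Z = {z::complex. ipoly q z = 0}"
  have "map_poly of_int q \<noteq> (0 :: complex poly)"
    using deg degree_map_poly_of_int[of q, where 'a=complex] by auto
  then have finZ: "finite Z" unfolding Z_def by (rule poly_roots_finite)
  have cardZ: "card Z = degree q"
    using rsquarefree_card_roots[OF irreducible_int_poly_rsquarefree[OF assms]]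
    by (simp add: Z_def degree_map_poly_of_int)
  define L where "L = (\<lambda>z. \<Prod>w\<in>Z - {z}. smult (1 / (z - w)) [:-w, 1:])"
  have L: "poly (L z) w = (if w = z then 1 else 0)" if "z \<in> Z" "w \<in> Z" for z w
    using that finZ
    by (auto simp: L_def poly_prod intro!: prod.neutral prod_zero bexI[of _ w] simp flip: diff_divide_distrib)
  have degL: "degree (L z) < degree q" if "z \<in> Z" for z
  proof -
    have "degree (L z) \<le> (\<Sum>w\<in>Z - {z}. degree (smult (1 / (z - w)) [:-w, 1:]))"
      unfolding L_def using finZ by (intro order.trans[OF degree_prod_sum_le]) auto
    also have "\<dots> \<le> (\<Sum>w\<in>Z - {z}. 1)" by (intro sum_mono) simp
    also have "\<dots> = degree q - 1" using that finZ cardZ by simp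
    finally show ?thesis using deg by simp
  qed
  \<comment> \<open>Summing over all \<open>i\<close> gives one bound for every coefficient. The
    \<open>max\<close> with 0 below keeps that bound nonnegative for the zero coefficients beyond
    the degree.\<close>
  define M where "M = (\<Sum>i<degree q. \<Sum>z\<in>Z. C * cmod (coeff (L z) i))"
  have bound: "\<bar>coeff P i\<bar> \<le> \<lceil>max M 0\<rceil>"
    if P: "degree P < degree q" "\<forall>z\<in>Z. cmod (ipoly P z) \<le> C" for P i
  proof (cases "i < degree q")
    case True
    have "map_poly of_int P = (\<Sum>z\<in>Z. smult (ipoly P z) (L z))"
    proof (rule poly_eqI_degree[of Z])
      fix w assume w: "w \<in> Z"
      have "poly (\<Sum>z\<in>Z. smult (ipoly P z) (L z)) w = (\<Sum>z\<in>Z. ipoly P z * (if w = z then 1 else 0))"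
        using w L by (simp add: poly_sum)
      also have "\<dots> = (\<Sum>z\<in>Z. if w = z then ipoly P z else 0)" by (intro sum.cong) auto
      finally show "ipoly P w = poly (\<Sum>z\<in>Z. smult (ipoly P z) (L z)) w"
        using w finZ by simp
    next
      show "degree (\<Sum>z\<in>Z. smult (ipoly P z) (L z)) < card Z"
        unfolding cardZ using degL deg
        by (intro degree_sum_less) (auto intro: le_less_trans[OF degree_smult_le])
    qed (use P cardZ in \<open>simp add: degree_map_poly_of_int\<close>)
    from arg_cong[OF this, of "\<lambda>p. coeff p i"]
    have "of_int (coeff P i) = (\<Sum>z\<in>Z. ipoly P z * coeff (L z) i)"
      by (simp add: coeff_map_poly coeff_sum)
    then have "\<bar>real_of_int (coeff P i)\<bar> = cmod (\<Sum>z\<in>Z. ipoly P z * coeff (L z) i)"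
      by (metis norm_of_int)
    also have "\<dots> \<le> (\<Sum>z\<in>Z. C * cmod (coeff (L z) i))"
      using P by (intro sum_norm_le) (auto simp: norm_mult intro!: mult_right_mono)
    also have "\<dots> \<le> M"
      unfolding M_def
    proof (rule member_le_sum)
      fix j
      show "0 \<le> (\<Sum>z\<in>Z. C * cmod (coeff (L z) j))"
        using P by (intro sum_nonneg mult_nonneg_nonneg) (auto intro: order.trans[OF norm_ge_zero])
    qed (use True in auto)
    finally show ?thesis by linarith
  next
    case False
    then show ?thesis using P by (simp add: coeff_eq_0)
  qed
  show ?thesis
    by (rule finite_subset[OF _ finite_int_polys_bounded_coeffs[of "degree q" "\<lceil>max M 0\<rceil>"]])
       (use bound in \<open>auto simp: Z_def\<close>)
qed

text \<open>Write \<open>q\<close> as \<open>a + X * q'\<close> with \<open>a\<close> equal to 1 or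
  -1. A root \<open>z\<close> then satisfies \<open>z * q'(z) = - a\<close>, so
  \<open>- a * q'\<close> takes the value \<open>1 / z\<close> there.\<close>

lemma inverse_mod_unit_poly:
  fixes q :: "int poly"
  assumes "coeff q 0 = 1 \<or> coeff q 0 = -1"
  obtains U :: "int poly" where "\<And>z::complex. ipoly q z = 0 \<Longrightarrow> z * ipoly U z = 1"
proof -
  obtain a q' where q: "q = pCons a q'" by (cases q)
  show thesis
  proof (rule that[of "smult (-a) q'"])
    fix z :: complex assume "ipoly q z = 0"
    then have "of_int a + z * ipoly q' z = 0" by (simp add: q ipoly_pCons)
    then show "z * ipoly (smult (-a) q') z = 1"
      using assms q by (auto simp: ipoly_smult ipoly_uminus add_eq_0_iff)
  qed
qed

text \<open>Among the powers of \<open>X\<close> modulo \<open>q\<close> and \<open>s\<close> two coincide; as \<open>X\<close> is invertible modulo \<open>q\<close>,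
  some positive power is \<open>1\<close>.\<close>

lemma power_eq_one_mod:
  fixes q :: "int poly" and s :: int
  assumes "lead_coeff q = 1" "degree q > 0" "coeff q 0 = 1 \<or> coeff q 0 = -1" and s: "s > 0"
  obtains n S where "n > 0" "\<And>z::complex. ipoly q z = 0 \<Longrightarrow> of_int s * ipoly S z = z ^ n - 1"
proof -
  have "\<exists>R A. [:0, 1:] ^ k = q * A + R \<and> degree R < degree q" for k
    by (rule monic_division[OF assms(1,2)]) blast
  then obtain R A where RA: "\<And>k. [:0, 1:] ^ k = q * A k + R k" "\<And>k. degree (R k) < degree q"
    by metis
  define g where "g = (\<lambda>k. map (\<lambda>i. coeff (R k) i mod s) [0..<degree q])"
  have "range g \<subseteq> {xs. set xs \<subseteq> {0..<s} \<and> length xs = degree q}"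
    using s by (auto simp: g_def)
  then have "finite (range g)"
    by (rule finite_subset) (intro finite_lists_length_eq, simp)
  then have "\<not> inj g" using finite_imageD[of g UNIV] by auto
  then obtain i j where ij: "i < j" "g i = g j"
    by (metis (full_types) injI linorder_less_linear)
  have "[:s:] dvd R j - R i"
    unfolding const_poly_dvd_iff
  proof
    fix k
    show "s dvd coeff (R j - R i) k"
    proof (cases "k < degree q")
      case True
      then have "coeff (R i) k mod s = coeff (R j) k mod s"
        using arg_cong[OF ij(2), of "\<lambda>xs. xs ! k"] by (simp add: g_def)
      then show ?thesis by (simp add: mod_eq_dvd_iff dvd_diff_commute)
    next
      case False
      then have "coeff (R a) k = 0" for a using RA(2)[of a] by (intro coeff_eq_0) simp
      then show ?thesis by simp
    qed
  qed
  then obtain S where S: "R j - R i = [:s:] * S" by blast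
  obtain U where U: "\<And>z::complex. ipoly q z = 0 \<Longrightarrow> z * ipoly U z = 1"
    using inverse_mod_unit_poly[OF assms(3)] by blast
  show thesis
  proof (rule that[of "j - i" "U ^ i * S"])
    fix z :: complex assume z: "ipoly q z = 0"
    have pow: "z ^ k = ipoly (R k) z" for k
      using arg_cong[OF RA(1)[of k], of "\<lambda>p. ipoly p z"] z by (simp add: ipoly_simps)
    have "of_int s * ipoly S z = z ^ j - z ^ i"
      using arg_cong[OF S, of "\<lambda>p. ipoly p z"] by (simp only: pow ipoly_simps)
    also have "\<dots> = z ^ i * (z ^ (j - i) - 1)"
      using ij by (simp add: algebra_simps flip: power_add)
    finally have "of_int s * ipoly S z = z ^ i * (z ^ (j - i) - 1)" .
    then have "of_int s * ipoly (U ^ i * S) z = ipoly U z ^ i * (z ^ i * (z ^ (j - i) - 1))"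
      by (simp add: ipoly_mult ipoly_power mult.left_commute)
    also have "\<dots> = (z * ipoly U z) ^ i * (z ^ (j - i) - 1)"
      by (simp add: power_mult_distrib mult_ac)
    finally show "of_int s * ipoly (U ^ i * S) z = z ^ (j - i) - 1" using U[OF z] by simp
  qed (use ij in simp)
qed

subsection \<open>Expansions in alternate bases\<close>

text \<open>The reciprocals are the place values: with digits indexed from 0, digit \<open>k\<close>
  has weight \<open>1 / base_prod b (Suc k)\<close>.\<close>

definition base_prod :: "(nat \<Rightarrow> real) \<Rightarrow> nat \<Rightarrow> real" where
  "base_prod b k = (\<Prod>i<k. b i)"

lemma base_prod_0 [simp]: "base_prod b 0 = 1"
  by (simp add: base_prod_def)

lemma base_prod_Suc: "base_prod b (Suc k) = base_prod b k * b k"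
  by (simp add: base_prod_def)

lemma base_prod_add: "base_prod b (m + k) = base_prod b m * base_prod (\<lambda>i. b (i + m)) k"
  by (induction k) (simp_all add: base_prod_Suc add.commute mult.assoc)

lemma beta_rem_bounds:
  assumes "0 \<le> x" "x < 1"
  shows "0 \<le> beta_rem b x k" "beta_rem b x k < 1"
proof -
  have "0 \<le> beta_rem b x k \<and> beta_rem b x k < 1"
  proof (cases k)
    case (Suc n)
    then show ?thesis by (simp, linarith)
  qed (use assms in simp)
  then show "0 \<le> beta_rem b x k" "beta_rem b x k < 1" by auto
qed

lemma beta_rem_Suc_digit: "beta_rem b x (Suc k) = b k * beta_rem b x k - of_int (beta_digit b x k)"
  by (simp add: beta_digit_def)

lemma beta_rem_add: "beta_rem b x (m + k) = beta_rem (\<lambda>i. b (i + m)) (beta_rem b x m) k"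
  by (induction k) (simp_all add: add.commute)

lemma beta_digit_add: "beta_digit b x (m + k) = beta_digit (\<lambda>i. b (i + m)) (beta_rem b x m) k"
  unfolding beta_digit_def beta_rem_add by (simp add: add.commute)

lemma beta_rem_stays_0: "beta_rem b x m = 0 \<Longrightarrow> m \<le> k \<Longrightarrow> beta_rem b x k = 0"
  by (induction k) (auto simp: le_Suc_eq)

locale alternate_base =
  fixes p :: nat and b :: "nat \<Rightarrow> real"
  assumes alt: "alt_base p b"
begin

abbreviation B :: "nat \<Rightarrow> real" where "B \<equiv> base_prod b"

definition \<delta> :: real where "\<delta> = base_prod b p"

lemma p_pos: "p > 0"
  using alt by (auto simp: alt_base_def)

lemma b_gt_1: "b k > 1"
  using alt by (auto simp: alt_base_def)

lemma b_periodic: "b (k + n * p) = b k"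
proof (induction n)
  case (Suc n)
  have "b (k + n * p + p) = b (k + n * p)" using alt by (simp add: alt_base_def)
  then show ?case using Suc by (simp add: algebra_simps)
qed simp

lemma B_ge_1: "B k \<ge> 1"
proof (induction k)
  case (Suc k)
  then show ?case using b_gt_1[of k] mult_mono[of 1 "B k" 1 "b k"] by (simp add: base_prod_Suc)
qed simp

lemma B_pos: "B k > 0"
  using B_ge_1[of k] by linarith

lemma B_gt_1: "k > 0 \<Longrightarrow> B k > 1"
  using b_gt_1 B_ge_1 by (cases k) (auto simp: base_prod_Suc less_1_mult' mult.commute)

lemma B_mono: "m \<le> k \<Longrightarrow> B m \<le> B k"
proof (induction rule: dec_induct)
  case (step n)
  have "B n * 1 \<le> B n * b n" using b_gt_1[of n] B_pos[of n] by (intro mult_left_mono) auto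
  then show ?case using step.IH by (simp add: base_prod_Suc)
qed simp

lemma \<delta>_gt_1: "\<delta> > 1"
  using B_gt_1[OF p_pos] by (simp add: \<delta>_def)

lemma B_period: "B (k + n * p) = \<delta> ^ n * B k"
proof -
  have one: "B (m + p) = \<delta> * B m" for m
    using base_prod_add[of b p m] b_periodic[of _ 1] by (simp add: \<delta>_def add.commute)
  show ?thesis
  proof (induction n)
    case (Suc n)
    have "B (k + Suc n * p) = B ((k + n * p) + p)" by (simp add: algebra_simps)
    then show ?case using Suc one by (simp add: mult.assoc)
  qed simp
qed

lemma B_power: "B (n * p) = \<delta> ^ n"
  using B_period[of 0 n] by simp

lemma b_bounded: "\<exists>A. \<forall>k. b k \<le> A"
proof (intro exI allI)
  fix k
  have "b k = b (k mod p)" using b_periodic[of "k mod p" "k div p"] by simp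
  also have "\<dots> \<le> Max (b ` {..<p})" using p_pos by (intro Max_ge) auto
  finally show "b k \<le> Max (b ` {..<p})" .
qed

lemma beta_digit_bounds:
  assumes "0 \<le> x" "x < 1"
  shows "0 \<le> beta_digit b x k" "beta_digit b x k \<le> b k"
proof -
  have r: "0 \<le> beta_rem b x k" "beta_rem b x k < 1" using beta_rem_bounds[OF assms] by auto
  then show "0 \<le> beta_digit b x k"
    unfolding beta_digit_def using b_gt_1[of k] by simp
  have "b k * beta_rem b x k \<le> b k * 1" using r b_gt_1[of k] by (intro mult_left_mono) auto
  then show "beta_digit b x k \<le> b k" unfolding beta_digit_def by linarith
qed

lemma beta_rem_period: "beta_rem b x (n * p + k) = beta_rem b (beta_rem b x (n * p)) k"
  by (simp add: beta_rem_add b_periodic)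

lemma beta_digit_period: "beta_digit b x (n * p + k) = beta_digit b (beta_rem b x (n * p)) k"
  by (simp add: beta_digit_add b_periodic)

lemma beta_expansion: "x = (\<Sum>k<n. of_int (beta_digit b x k) / B (Suc k)) + beta_rem b x n / B n"
proof (induction n)
  case (Suc n)
  have "of_int (beta_digit b x n) / B (Suc n) + beta_rem b x (Suc n) / B (Suc n) = b n * beta_rem b x n / B (Suc n)"
    by (simp add: beta_rem_Suc_digit diff_divide_distrib del: beta_rem.simps)
  also have "\<dots> = beta_rem b x n / B n" using b_gt_1[of n] by (simp add: base_prod_Suc)
  finally show ?case using Suc by simp
qed simp

text \<open>Division by \<open>B m\<close> puts \<open>m\<close> zeros in front of the expansion: up
  to step \<open>m\<close> the products formed by the algorithm stay below 1, so it only
  multiplies.\<close>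

lemma beta_rem_divide:
  assumes "0 \<le> x" "x < 1" "k \<le> m"
  shows "beta_rem b (x / B m) k = x * B k / B m"
  using assms(3)
proof (induction k)
  case (Suc k)
  have "B (Suc k) \<le> B m" using Suc.prems by (rule B_mono)
  then have "x * B (Suc k) / B m \<le> x * 1"
    using assms B_pos[of m] by (simp add: divide_le_eq mult_left_mono)
  moreover have "b k * beta_rem b (x / B m) k = x * B (Suc k) / B m"
    using Suc by (simp add: base_prod_Suc)
  moreover have "0 \<le> x * B (Suc k) / B m" using assms B_pos[of m] B_pos[of "Suc k"] by simp
  ultimately show ?case using assms by (simp add: floor_eq_iff)
qed simp

lemma beta_rem_divide_add:
  assumes "0 \<le> x" "x < 1"
  shows "beta_rem b (x / B m) (m + k) = beta_rem (\<lambda>i. b (i + m)) x k"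
  using beta_rem_divide[OF assms, of m m] B_pos[of m] by (simp add: beta_rem_add)

text \<open>Once all digits vanish, the remainder is multiplied by \<delta> in every period. It
  stays below 1, so it must be 0.\<close>

lemma in_Fin_iff: "x \<in> Fin b \<longleftrightarrow> 0 \<le> x \<and> x < 1 \<and> (\<exists>N. beta_rem b x N = 0)"
proof (intro iffI)
  assume "0 \<le> x \<and> x < 1 \<and> (\<exists>N. beta_rem b x N = 0)"
  then obtain N where N: "0 \<le> x" "x < 1" "beta_rem b x N = 0" by auto
  have "\<forall>k\<ge>N. beta_digit b x k = 0"
    using beta_rem_stays_0[OF N(3)] by (simp add: beta_digit_def)
  then show "x \<in> Fin b" using N by (auto simp: Fin_def)
next
  assume "x \<in> Fin b"
  then obtain N where N: "0 \<le> x" "x < 1" "\<And>k. k \<ge> N \<Longrightarrow> beta_digit b x k = 0"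
    by (auto simp: Fin_def)
  define r where "r = beta_rem b x N"
  have grow: "beta_rem b x (N + k) * B N = r * B (N + k)" for k
  proof (induction k)
    case (Suc k)
    have "beta_rem b x (N + Suc k) = b (N + k) * beta_rem b x (N + k)"
      using N(3)[of "N + k"] by (simp add: beta_digit_def)
    then show ?case using Suc by (simp add: base_prod_Suc mult_ac)
  qed (simp add: r_def)
  have "r * \<delta> ^ n < 1" for n
  proof -
    have "r * \<delta> ^ n = beta_rem b x (N + n * p)"
      using grow[of "n * p"] B_pos[of N] by (simp add: B_period)
    then show ?thesis using beta_rem_bounds[OF N(1,2)] by simp
  qed
  moreover have "\<exists>n. \<delta> ^ n > 1 / r" if "r > 0" using \<delta>_gt_1 real_arch_pow by blast
  ultimately have "\<not> r > 0" by (auto simp: field_simps) (metis less_asym mult.commute)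
  then show "0 \<le> x \<and> x < 1 \<and> (\<exists>N. beta_rem b x N = 0)"
    using N beta_rem_bounds(1)[OF N(1,2), of b N] by (auto simp: r_def intro!: exI[of _ N])
qed

section \<open>Shifted bases and finite expansions\<close>

lemma alternate_base_shift: "alternate_base p (\<lambda>k. b (k + i))"
proof
  have "b (k + p + i) = b (k + i)" for k
    using b_periodic[of "k + i" 1] by (simp add: ac_simps)
  then show "alt_base p (\<lambda>k. b (k + i))" using alt by (simp add: alt_base_def)
qed

text \<open>After \<open>m\<close> leading zeros the algorithm continues on \<open>x\<close> in the
  shifted base. This is the bridge along which finiteness and Property (F) pass to shifts.\<close>

lemma divide_in_Fin_iff:
  assumes "0 \<le> x" "x < 1"
  shows "x / B m \<in> Fin b \<longleftrightarrow> x \<in> Fin (\<lambda>k. b (k + m))"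
proof -
  interpret sh: alternate_base p "\<lambda>k. b (k + m)" by (rule alternate_base_shift)
  have xm: "0 \<le> x / B m" "x / B m < 1"
    using assms B_ge_1[of m] by (auto simp: divide_less_eq)
  have "(\<exists>N. beta_rem b (x / B m) N = 0) \<longleftrightarrow> (\<exists>N. beta_rem (\<lambda>i. b (i + m)) x N = 0)"
  proof
    assume "\<exists>N. beta_rem b (x / B m) N = 0"
    then obtain N where "beta_rem b (x / B m) N = 0" by blast
    then have "beta_rem b (x / B m) (m + N) = 0" by (rule beta_rem_stays_0) simp
    then show "\<exists>N. beta_rem (\<lambda>i. b (i + m)) x N = 0" using beta_rem_divide_add[OF assms] by auto
  qed (use beta_rem_divide_add[OF assms] in metis)
  then show ?thesis using assms xm by (simp add: in_Fin_iff sh.in_Fin_iff)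
qed

lemma divide_power_in_Fin_iff:
  assumes "0 \<le> x" "x < 1"
  shows "x / \<delta> ^ n \<in> Fin b \<longleftrightarrow> x \<in> Fin b"
  using divide_in_Fin_iff[OF assms, of "n * p"] by (simp add: B_power b_periodic)

text \<open>With \<open>k = Suc m\<close>, the number \<open>1 / b m\<close> has the single digit 1
  in the base shifted by \<open>m\<close>. For \<open>k = 0\<close> the value would be 1, outside
  the unit interval.\<close>

lemma inverse_B_in_Fin: "k > 0 \<Longrightarrow> 1 / B k \<in> Fin b"
proof -
  assume "k > 0"
  then obtain m where k: "k = Suc m" by (cases k) auto
  have x: "0 \<le> 1 / b m" "1 / b m < 1" using b_gt_1[of m] by auto
  interpret sh: alternate_base p "\<lambda>k. b (k + m)" by (rule alternate_base_shift)
  have "beta_rem (\<lambda>k. b (k + m)) (1 / b m) (Suc 0) = 0" using b_gt_1[of m] by simp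
  then have "1 / b m \<in> Fin (\<lambda>k. b (k + m))" using x unfolding sh.in_Fin_iff by blast
  then have "1 / b m / B m \<in> Fin b" using divide_in_Fin_iff[OF x] by simp
  then show ?thesis by (simp add: k base_prod_Suc mult.commute)
qed

lemma beta_rem_in_Fin:
  assumes "x \<in> Fin b"
  shows "beta_rem b x (n * p) \<in> Fin b"
proof -
  obtain N where N: "0 \<le> x" "x < 1" "beta_rem b x N = 0" using assms in_Fin_iff by auto
  then have "beta_rem b x (n * p + N) = 0" using beta_rem_stays_0 by auto
  then show ?thesis using beta_rem_bounds[OF N(1,2)] by (auto simp: in_Fin_iff beta_rem_period)
qed

lemma property_F_shift:
  assumes "property_F b"
  shows "property_F (\<lambda>k. b (k + i))"
  unfolding property_F_def
proof (intro ballI conjI impI)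
  fix x y assume xy: "x \<in> Fin (\<lambda>k. b (k + i))" "y \<in> Fin (\<lambda>k. b (k + i))"
  then have b01: "0 \<le> x" "x < 1" "0 \<le> y" "y < 1" by (auto simp: Fin_def)
  then have F: "x / B i \<in> Fin b" "y / B i \<in> Fin b" using xy divide_in_Fin_iff by auto
  have *: "0 \<le> t / B i \<and> t / B i < 1" if "0 \<le> t \<and> t < 1" for t
    using that B_ge_1[of i] by (auto simp: divide_less_eq)
  {
    assume s: "0 \<le> x + y \<and> x + y < 1"
    then have "(x + y) / B i \<in> Fin b"
      using assms F *[OF s] unfolding property_F_def by (metis add_divide_distrib)
    then show "x + y \<in> Fin (\<lambda>k. b (k + i))" using s divide_in_Fin_iff by auto
  next
    assume s: "0 \<le> x - y \<and> x - y < 1"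
    then have "(x - y) / B i \<in> Fin b"
      using assms F *[OF s] unfolding property_F_def by (metis diff_divide_distrib)
    then show "x - y \<in> Fin (\<lambda>k. b (k + i))" using s divide_in_Fin_iff by auto
  }
qed

end

text \<open>The sum up to \<open>N + p\<close> is its first \<open>p\<close> terms plus a shifted
  sum of at most \<rho> times the sum up to \<open>N\<close>; solving the inequality gives the
  bound. It serves both for the functional on place values and for conjugates.\<close>

lemma periodic_decay_bounded_sums:
  fixes h :: "nat \<Rightarrow> 'a::real_normed_vector"
  assumes "\<And>k. norm (h (k + p)) \<le> \<rho> * norm (h k)" "0 \<le> \<rho>" "\<rho> < 1"
  shows "\<exists>H. \<forall>N. (\<Sum>k<N. norm (h k)) \<le> H"
proof (intro exI allI)
  fix N
  let ?S = "\<lambda>N. \<Sum>k<N. norm (h k)"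
  have "?S N \<le> ?S (N + p)" by (intro sum_mono2) auto
  also have "\<dots> = ?S p + (\<Sum>k<N. norm (h (k + p)))"
    using sum.atLeastLessThan_shift_bounds[of "\<lambda>k. norm (h k)" 0 p N]
      sum.atLeastLessThan_concat[of 0 p "N + p" "\<lambda>k. norm (h k)"]
    by (simp add: atLeast0LessThan add.commute)
  also have "\<dots> \<le> ?S p + (\<Sum>k<N. \<rho> * norm (h k))"
    using assms(1) by (intro add_left_mono sum_mono)
  also have "\<dots> = ?S p + \<rho> * ?S N" by (simp add: sum_distrib_left)
  finally show "?S N \<le> ?S p / (1 - \<rho>)" using assms(3) by (simp add: field_simps)
qed

lemma norm_weighted_sum_le:
  fixes h :: "nat \<Rightarrow> 'a::real_normed_algebra_1"
  assumes "\<And>k. \<bar>real_of_int (d k)\<bar> \<le> A" "(\<Sum>k<N. norm (h k)) \<le> H" "0 \<le> A"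
  shows "norm (\<Sum>k<N. of_int (d k) * h k) \<le> A * H"
proof -
  have "norm (\<Sum>k<N. of_int (d k) * h k) \<le> (\<Sum>k<N. A * norm (h k))"
    using assms(1)
    by (intro sum_norm_le order.trans[OF norm_mult_ineq]) (simp add: mult_right_mono)
  also have "\<dots> \<le> A * H" using assms(2,3) by (simp add: mult_left_mono flip: sum_distrib_left)
  finally show ?thesis .
qed

subsection \<open>Consequences of Property (F)\<close>

text \<open>A subspace containing \<open>1\<close> and maximal among those avoiding \<open>u\<close> is a complement of the
  line spanned by \<open>u\<close>; the functional is the coordinate along \<open>u\<close>.\<close>

lemma linear_functional_over_subfield:
  fixes K :: "'a::field set"
  assumes one: "1 \<in> K" and add: "\<And>x y. x \<in> K \<Longrightarrow> y \<in> K \<Longrightarrow> x + y \<in> K"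
    and mult: "\<And>x y. x \<in> K \<Longrightarrow> y \<in> K \<Longrightarrow> x * y \<in> K"
    and neg: "\<And>x. x \<in> K \<Longrightarrow> - x \<in> K" and inv: "\<And>x. x \<in> K \<Longrightarrow> inverse x \<in> K"
    and u: "u \<notin> K"
  obtains \<phi> :: "'a \<Rightarrow> 'a" where "\<And>x y. \<phi> (x + y) = \<phi> x + \<phi> y"
    "\<And>k x. k \<in> K \<Longrightarrow> \<phi> (k * x) = k * \<phi> x" "\<phi> 1 = 0" "\<phi> u = 1"
proof -
  have zero: "0 \<in> K" using add[OF one neg[OF one]] by simp
  define \<W> where "\<W> = {W. 1 \<in> W \<and> u \<notin> W \<and> (\<forall>x\<in>W. \<forall>y\<in>W. x + y \<in> W) \<and> (\<forall>k\<in>K. \<forall>x\<in>W. k * x \<in> W)}"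
  have "K \<in> \<W>" using one add mult u by (auto simp: \<W>_def)
  have "\<exists>M\<in>\<W>. \<forall>X\<in>\<W>. M \<subseteq> X \<longrightarrow> X = M"
  proof (rule subset_Zorn_nonempty)
    fix C assume C: "C \<noteq> {}" "subset.chain \<W> C"
    then have sub: "C \<subseteq> \<W>" by (auto simp: subset.chain_def)
    have "x + y \<in> \<Union>C" if xy: "x \<in> \<Union>C" "y \<in> \<Union>C" for x y
    proof -
      obtain X Y where XY: "X \<in> C" "x \<in> X" "Y \<in> C" "y \<in> Y" using xy by blast
      then consider "X \<subseteq> Y" | "Y \<subseteq> X" using C(2) by (auto simp: subset_chain_def)
      then show ?thesis
      proof cases
        case 1
        then have "x + y \<in> Y" using XY sub unfolding \<W>_def by blast
        then show ?thesis using XY by blast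
      next
        case 2
        then have "x + y \<in> X" using XY sub unfolding \<W>_def by blast
        then show ?thesis using XY by blast
      qed
    qed
    moreover have "k * x \<in> \<Union>C" if "k \<in> K" "x \<in> \<Union>C" for k x
      using that sub unfolding \<W>_def by blast
    moreover have "1 \<in> \<Union>C" "u \<notin> \<Union>C" using C(1) sub unfolding \<W>_def by blast+
    ultimately show "\<Union>C \<in> \<W>" by (auto simp: \<W>_def)
  qed (use \<open>K \<in> \<W>\<close> in blast)
  then obtain W where "W \<in> \<W>" and max: "\<And>X. X \<in> \<W> \<Longrightarrow> W \<subseteq> X \<Longrightarrow> X = W" by blast
  then have W: "1 \<in> W" "u \<notin> W" "\<And>x y. x \<in> W \<Longrightarrow> y \<in> W \<Longrightarrow> x + y \<in> W"
    "\<And>k x. k \<in> K \<Longrightarrow> x \<in> W \<Longrightarrow> k * x \<in> W" by (auto simp: \<W>_def)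
  have Wneg: "- x \<in> W" if "x \<in> W" for x using W(4)[OF neg[OF one] that] by simp
  have W0: "0 \<in> W" using W(3)[OF W(1) Wneg[OF W(1)]] by simp
  have ex: "\<exists>k\<in>K. g - k * u \<in> W" for g
  proof (cases "g \<in> W")
    case True
    then show ?thesis using zero by (intro bexI[of _ 0]) auto
  next
    case False
    \<comment> \<open>\<open>X\<close> is the subspace spanned by \<open>W\<close> and
      \<open>g\<close>. By maximality of \<open>W\<close> it must contain \<open>u\<close>, and
      solving for \<open>g\<close> gives its coordinate.\<close>
    define X where "X = {w + k * g | w k. w \<in> W \<and> k \<in> K}"
    have XI: "w + k * g \<in> X" if "w \<in> W" "k \<in> K" for w k using that by (auto simp: X_def)
    have "W \<subseteq> X" using XI[OF _ zero] by auto
    moreover have "g \<in> X" using XI[OF W0 one] by simp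
    ultimately have "X \<notin> \<W>" using max False by auto
    moreover have "x + y \<in> X" if "x \<in> X" "y \<in> X" for x y
    proof -
      obtain w k w' k' where "x = w + k * g" "y = w' + k' * g" "w \<in> W" "w' \<in> W" "k \<in> K" "k' \<in> K"
        using \<open>x \<in> X\<close> \<open>y \<in> X\<close> by (auto simp: X_def)
      then show ?thesis using XI[of "w + w'" "k + k'"] W(3) add by (simp add: algebra_simps)
    qed
    moreover have "l * x \<in> X" if "l \<in> K" "x \<in> X" for l x
    proof -
      obtain w k where "x = w + k * g" "w \<in> W" "k \<in> K" using \<open>x \<in> X\<close> by (auto simp: X_def)
      then show ?thesis using XI[of "l * w" "l * k"] W(4) mult \<open>l \<in> K\<close> by (simp add: algebra_simps)
    qed
    moreover have "1 \<in> X" using W(1) \<open>W \<subseteq> X\<close> by blast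
    ultimately have "u \<in> X" by (auto simp: \<W>_def)
    then obtain w k where wk: "u = w + k * g" "w \<in> W" "k \<in> K" by (auto simp: X_def)
    then have "k \<noteq> 0" using W(2) by auto
    then have "g - inverse k * u = (- inverse k) * w" using wk(1) by (simp add: field_simps)
    then show ?thesis using W(4)[OF neg[OF inv] wk(2)] inv wk(3) by metis
  qed
  define \<phi> where "\<phi> g = (SOME k. k \<in> K \<and> g - k * u \<in> W)" for g
  have \<phi>: "\<phi> g \<in> K" "g - \<phi> g * u \<in> W" for g
    using someI_ex[of "\<lambda>k. k \<in> K \<and> g - k * u \<in> W"] ex[of g] unfolding \<phi>_def by blast+
  \<comment> \<open>Two different coordinates would put a nonzero multiple of \<open>u\<close> into
    \<open>W\<close>. Uniqueness makes the choice of \<phi> linear.\<close>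
  have unique: "\<phi> g = k" if k: "k \<in> K" "g - k * u \<in> W" for g k
  proof (rule ccontr)
    assume "\<phi> g \<noteq> k"
    then have nz: "k - \<phi> g \<noteq> 0" by simp
    have "(g - \<phi> g * u) + - (g - k * u) \<in> W" by (intro W(3) Wneg \<phi> k)
    then have "(k - \<phi> g) * u \<in> W" by (simp add: algebra_simps)
    moreover have "inverse (k - \<phi> g) \<in> K"
      using inv[OF add[OF k(1) neg[OF \<phi>(1)[of g]]]] by simp
    ultimately have "inverse (k - \<phi> g) * ((k - \<phi> g) * u) \<in> W" using W(4) by blast
    then show False using nz W(2) by (simp add: mult.assoc[symmetric])
  qed
  show thesis
  proof (rule that)
    fix x y
    have "(x - \<phi> x * u) + (y - \<phi> y * u) \<in> W" by (intro W(3) \<phi>)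
    then show "\<phi> (x + y) = \<phi> x + \<phi> y"
      by (intro unique add \<phi>) (simp add: algebra_simps)
  next
    fix k x assume k: "k \<in> K"
    have "k * (x - \<phi> x * u) \<in> W" by (intro W(4) \<phi> k)
    then show "\<phi> (k * x) = k * \<phi> x"
      by (intro unique mult \<phi> k) (simp add: algebra_simps)
  qed (use unique[of 0 1] unique[of 1 u] zero one W(1) W0 in auto)
qed

locale finitary_base = alternate_base +
  assumes F: "property_F b"
begin

text \<open>Frees \<open>Fin b\<close> from the unit interval: differences provide signs, powers of
  \<delta> provide arbitrary size. Under (F) this is closed under addition.\<close>

definition Fin_module :: "real set" where
  "Fin_module = {\<delta> ^ n * (u - v) | n u v. u \<in> Fin b \<and> v \<in> Fin b}"

lemma Fin_bounds: "u \<in> Fin b \<Longrightarrow> 0 \<le> u" "u \<in> Fin b \<Longrightarrow> u < 1"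
  by (auto simp: Fin_def)

lemma zero_in_Fin: "0 \<in> Fin b"
  by (auto simp: in_Fin_iff intro: exI[of _ 0])

lemma Fin_add: "x \<in> Fin b \<Longrightarrow> y \<in> Fin b \<Longrightarrow> x + y < 1 \<Longrightarrow> x + y \<in> Fin b"
  using F Fin_bounds(1) unfolding property_F_def by (meson add_nonneg_nonneg)

lemma Fin_diff: "x \<in> Fin b \<Longrightarrow> y \<in> Fin b \<Longrightarrow> 0 \<le> x - y \<Longrightarrow> x - y \<in> Fin b"
proof -
  assume xy: "x \<in> Fin b" "y \<in> Fin b" "0 \<le> x - y"
  then have "x - y < 1" using Fin_bounds(2)[of x] Fin_bounds(1)[of y] by linarith
  then show ?thesis using F xy unfolding property_F_def by blast
qed

lemma Fin_moduleI: "u \<in> Fin b \<Longrightarrow> v \<in> Fin b \<Longrightarrow> \<delta> ^ n * (u - v) \<in> Fin_module"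
  by (auto simp: Fin_module_def)

lemma Fin_module_add:
  assumes "x \<in> Fin_module" "y \<in> Fin_module"
  shows "x + y \<in> Fin_module"
proof -
  obtain n u v m u' v' where x: "x = \<delta> ^ n * (u - v)" "u \<in> Fin b" "v \<in> Fin b"
    and y: "y = \<delta> ^ m * (u' - v')" "u' \<in> Fin b" "v' \<in> Fin b"
    using assms by (auto simp: Fin_module_def)
  \<comment> \<open>With this \<open>c\<close> every rescaled summand is below 1/2, so the sums of
    two stay below 1 and (F) applies. The crossed exponents \<open>m + c\<close> and
    \<open>n + c\<close> bring both elements to the common power \<open>n + m + c\<close>.\<close>
  obtain c where c: "\<delta> ^ c > 2" using real_arch_pow[OF \<delta>_gt_1] by blast
  have small: "t / \<delta> ^ (k + c) < 1 / 2" if "t \<in> Fin b" for t k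
  proof -
    have "\<delta> ^ (k + c) \<ge> 1 * \<delta> ^ c" unfolding power_add using \<delta>_gt_1 by (intro mult_right_mono) auto
    then show ?thesis using Fin_bounds[OF that] c by (simp add: field_simps)
  qed
  have sumFin: "s / \<delta> ^ (m + c) + t / \<delta> ^ (n + c) \<in> Fin b" if st: "s \<in> Fin b" "t \<in> Fin b" for s t
  proof -
    have "s / \<delta> ^ (m + c) \<in> Fin b" "t / \<delta> ^ (n + c) \<in> Fin b"
      using st divide_power_in_Fin_iff Fin_bounds by auto
    then show ?thesis
      using small[OF st(1), of m] small[OF st(2), of n] by (intro Fin_add) linarith+
  qed
  have cancel: "\<delta> ^ (n + m + c) * (t / \<delta> ^ (m + c)) = \<delta> ^ n * t"
    "\<delta> ^ (n + m + c) * (t / \<delta> ^ (n + c)) = \<delta> ^ m * t" for t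
    using \<delta>_gt_1 by (simp_all add: power_add)
  have "x + y = \<delta> ^ (n + m + c) * ((u / \<delta> ^ (m + c) + u' / \<delta> ^ (n + c)) - (v / \<delta> ^ (m + c) + v' / \<delta> ^ (n + c)))"
    unfolding right_diff_distrib distrib_left cancel by (simp add: x y algebra_simps)
  then show ?thesis using Fin_moduleI sumFin x y by metis
qed

lemma Fin_module_uminus: "x \<in> Fin_module \<Longrightarrow> - x \<in> Fin_module"
  using Fin_moduleI by (force simp: Fin_module_def simp flip: mult_minus_right simp del: mult_minus_right)

lemma Fin_subset_module: "x \<in> Fin b \<Longrightarrow> x \<in> Fin_module"
  using Fin_moduleI[of x 0 0] zero_in_Fin by simp

lemma Fin_module_mult: "x \<in> Fin_module \<Longrightarrow> \<delta> * x \<in> Fin_module"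
  unfolding Fin_module_def by clarify (metis mult.assoc power_Suc)

lemma Fin_module_of_nat: "x \<in> Fin_module \<Longrightarrow> of_nat n * x \<in> Fin_module"
  by (induction n) (auto simp: algebra_simps intro: Fin_module_add Fin_subset_module zero_in_Fin)

lemma Fin_module_of_int: "x \<in> Fin_module \<Longrightarrow> of_int n * x \<in> Fin_module"
  using Fin_module_of_nat[of x "nat n"] Fin_module_uminus[OF Fin_module_of_nat[of x "nat (-n)"]]
  by (cases "n \<ge> 0") auto

lemma one_in_Fin_module: "1 \<in> Fin_module"
proof -
  have "1 / B p \<in> Fin_module" by (intro Fin_subset_module inverse_B_in_Fin p_pos)
  then have "\<delta> * (1 / B p) \<in> Fin_module" by (rule Fin_module_mult)
  then show ?thesis using B_pos[of p] by (simp add: \<delta>_def)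
qed

lemma ipoly_in_Fin_module: "ipoly P \<delta> \<in> Fin_module"
proof (induction P)
  case (pCons a P)
  then show ?case
    using Fin_module_of_int[OF one_in_Fin_module, of a]
    by (auto simp: ipoly_pCons intro: Fin_module_add Fin_module_mult)
qed (simp add: Fin_subset_module zero_in_Fin)

text \<open>Division by \<open>\<delta> ^ n\<close> leaves a difference of elements of
  \<open>Fin b\<close>, which (F) covers; multiplying back only removes leading zeros.\<close>

lemma Fin_module_in_Fin:
  assumes "x \<in> Fin_module" "0 \<le> x" "x < 1"
  shows "x \<in> Fin b"
proof -
  obtain n u v where x: "x = \<delta> ^ n * (u - v)" "u \<in> Fin b" "v \<in> Fin b"
    using assms by (auto simp: Fin_module_def)
  have "u - v = x / \<delta> ^ n" using x \<delta>_gt_1 by simp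
  moreover have "0 \<le> x / \<delta> ^ n" using assms \<delta>_gt_1 by simp
  ultimately have "x / \<delta> ^ n \<in> Fin b" using Fin_diff x by metis
  then show ?thesis using divide_power_in_Fin_iff assms by simp
qed

text \<open>Property (F) forces the base into the field of \<open>\<delta>\<close>: a functional \<open>\<phi>\<close> that is linear over
  this field is bounded on \<open>Fin b\<close>, but if \<open>\<phi>\<close> kills \<open>1\<close> and not \<open>u = 1 / B j\<close>, it is unbounded on
  the fractional parts of the multiples of \<open>u\<close>.\<close>

lemma inverse_B_in_field:
  assumes j: "j > 0"
  shows "\<exists>P D. ipoly D \<delta> \<noteq> 0 \<and> 1 / B j = ipoly P \<delta> / ipoly D \<delta>"
proof (rule ccontr)
  define K where "K = {ipoly P \<delta> / ipoly D \<delta> | P D. ipoly D \<delta> \<noteq> 0}"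
  define u where "u = 1 / B j"
  assume "\<not> ?thesis"
  then have u: "u \<notin> K" by (auto simp: K_def u_def)
  have KI: "ipoly P \<delta> / ipoly D \<delta> \<in> K" if "ipoly D \<delta> \<noteq> 0" for P D
    using that by (auto simp: K_def)
  have "1 \<in> K" using KI[of 1 1] by simp
  moreover have "x + y \<in> K \<and> x * y \<in> K" if "x \<in> K" "y \<in> K" for x y
  proof -
    obtain P D P' D' where "x = ipoly P \<delta> / ipoly D \<delta>" "ipoly D \<delta> \<noteq> 0"
        "y = ipoly P' \<delta> / ipoly D' \<delta>" "ipoly D' \<delta> \<noteq> 0"
      using \<open>x \<in> K\<close> \<open>y \<in> K\<close> unfolding K_def by blast
    then show ?thesis
      using KI[of "D * D'" "P * D' + P' * D"] KI[of "D * D'" "P * P'"]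
      by (simp add: ipoly_simps add_frac_eq)
  qed
  moreover have neg: "- x \<in> K" if "x \<in> K" for x
  proof -
    from that obtain P D where "x = ipoly P \<delta> / ipoly D \<delta>" "ipoly D \<delta> \<noteq> 0"
      unfolding K_def by blast
    then show ?thesis using KI[of D "- P"] by (simp add: ipoly_simps)
  qed
  moreover have inv: "inverse x \<in> K" if "x \<in> K" for x
  proof -
    from that obtain P D where x: "x = ipoly P \<delta> / ipoly D \<delta>" "ipoly D \<delta> \<noteq> 0"
      unfolding K_def by blast
    show ?thesis
    proof (cases "ipoly P \<delta> = 0")
      case True
      then show ?thesis using x that by simp
    next
      case False
      then show ?thesis using KI[of P D] x by simp
    qed
  qed
  ultimately obtain \<phi> where add: "\<And>x y. \<phi> (x + y) = \<phi> x + \<phi> y"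
    and lin: "\<And>k x. k \<in> K \<Longrightarrow> \<phi> (k * x) = k * \<phi> x" and \<phi>1: "\<phi> 1 = 0" and \<phi>u: "\<phi> u = 1"
    using linear_functional_over_subfield[of K u] u by blast
  have int: "of_int n \<in> K" for n using KI[of 1 "[:n:]"] by (simp add: ipoly_simps)
  have "\<delta> \<in> K" using KI[of 1 "[:0, 1:]"] by (simp add: ipoly_simps)
  have \<phi>0: "\<phi> 0 = 0" using add[of 0 0] by simp
  have \<phi>sum: "\<phi> (\<Sum>i<n. f i) = (\<Sum>i<n. \<phi> (f i))" for f and n :: nat
    by (induction n) (simp_all add: \<phi>0 add)
  obtain A where A: "\<And>k. b k \<le> A" using b_bounded by blast
  then have "A \<ge> 0" using b_gt_1[of 0] A[of 0] by linarith
  \<comment> \<open>As \<open>inverse \<delta>\<close> lies in \<open>K\<close>, the functional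
    shrinks by the factor \<open>1 / \<delta>\<close> over each period of place values, so its
    values have bounded sums.\<close>
  have "norm (\<phi> (1 / B (Suc (k + p)))) \<le> 1 / \<delta> * norm (\<phi> (1 / B (Suc k)))" for k
  proof -
    have "1 / B (Suc (k + p)) = inverse \<delta> * (1 / B (Suc k))"
      using B_period[of "Suc k" 1] \<delta>_gt_1 by (simp add: field_simps)
    then show ?thesis using lin[OF inv[OF \<open>\<delta> \<in> K\<close>]] \<delta>_gt_1 by (simp add: abs_mult divide_inverse)
  qed
  from periodic_decay_bounded_sums[where h = "\<lambda>k. \<phi> (1 / B (Suc k))", OF this] \<delta>_gt_1
  obtain H where H: "\<And>N. (\<Sum>k<N. norm (\<phi> (1 / B (Suc k)))) \<le> H" by auto
  have bound: "\<bar>\<phi> x\<bar> \<le> A * H" if x: "x \<in> Fin b" for x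
  proof -
    obtain N where N: "0 \<le> x" "x < 1" "beta_rem b x N = 0" using x in_Fin_iff by auto
    have "\<phi> x = \<phi> (\<Sum>k<N. of_int (beta_digit b x k) * (1 / B (Suc k)))"
      using beta_expansion[of x N] N by simp
    also have "\<dots> = (\<Sum>k<N. of_int (beta_digit b x k) * \<phi> (1 / B (Suc k)))"
      unfolding \<phi>sum by (intro sum.cong refl lin int)
    finally show ?thesis
      using norm_weighted_sum_le[of "beta_digit b x" A "\<lambda>k. \<phi> (1 / B (Suc k))" N H]
        beta_digit_bounds[OF N(1,2)] A H \<open>A \<ge> 0\<close>
      by (fastforce intro: order.trans)
  qed
  obtain n :: nat where n: "real n > A * H" using reals_Archimedean2 by blast
  \<comment> \<open>The fractional part of \<open>n * u\<close>. The factor 1 is written out so that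
    linearity and \<open>\<phi> 1 = 0\<close> remove the integer part.\<close>
  define x where "x = of_nat n * u + of_int (- \<lfloor>of_nat n * u\<rfloor>) * 1"
  have "x \<in> Fin_module" unfolding x_def u_def
    by (intro Fin_module_add Fin_module_of_nat Fin_module_of_int Fin_subset_module
        inverse_B_in_Fin j one_in_Fin_module)
  moreover have "0 \<le> x" "x < 1" unfolding x_def by (simp, linarith)+
  ultimately have "\<bar>\<phi> x\<bar> \<le> A * H" by (intro bound Fin_module_in_Fin)
  moreover have "\<phi> x = of_nat n"
    using lin[OF int, of "int n" u] lin[OF int, of "- \<lfloor>of_nat n * u\<rfloor>" 1] \<phi>1 \<phi>u
    unfolding x_def add by simp
  ultimately show False using n by simp
qed

end

subsection \<open>Conjugates and pure periodicity\<close>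

context alternate_base
begin

text \<open>\<open>tail_prod k\<close> is the product of the last \<open>k\<close> entries of any sufficiently long block of
  full periods.\<close>

definition tail_prod :: "nat \<Rightarrow> real" where
  "tail_prod k = \<delta> ^ (k div p) * (\<delta> / B (p - k mod p))"

lemma B_tail_prod:
  assumes "k \<le> n * p"
  shows "B (n * p - k) * tail_prod k = \<delta> ^ n"
proof -
  \<comment> \<open>Both indices are raised by full periods until they agree, so that
    \<open>B_period\<close> applies to each side. If \<open>p\<close> divides \<open>k\<close>, then
    \<open>p - k mod p\<close> is \<open>p\<close> and the quotient in \<open>tail_prod k\<close> is
    1.\<close>
  have "n * p - k + Suc (k div p) * p = (p - k mod p) + n * p"
    using assms mod_less_divisor[OF p_pos, of k] div_mult_mod_eq[of k p]
    unfolding mult_Suc by linarith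
  then have "B (n * p - k) * (\<delta> ^ (k div p) * \<delta>) = \<delta> ^ n * B (p - k mod p)"
    using B_period[of "n * p - k" "Suc (k div p)"] B_period[of "p - k mod p" n] by (simp add: mult_ac)
  then show ?thesis using B_pos[of "p - k mod p"] by (simp add: tail_prod_def field_simps)
qed

lemma tail_prod_0 [simp]: "tail_prod 0 = 1"
  using B_tail_prod[of 0 0] by simp

lemma tail_prod_period: "tail_prod (n * p) = \<delta> ^ n"
  using B_tail_prod[of "n * p" n] by simp

lemma tail_prod_pos: "tail_prod k > 0"
  using \<delta>_gt_1 B_pos by (simp add: tail_prod_def)

lemma tail_prod_Suc:
  assumes "Suc k \<le> n * p"
  shows "tail_prod (Suc k) = b (n * p - Suc k) * tail_prod k"
proof -
  have "B (n * p - k) = B (n * p - Suc k) * b (n * p - Suc k)"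
    using base_prod_Suc[of b "n * p - Suc k"] assms by (simp add: Suc_diff_Suc)
  then have "B (n * p - Suc k) * tail_prod (Suc k) = B (n * p - Suc k) * (b (n * p - Suc k) * tail_prod k)"
    using B_tail_prod[OF assms] B_tail_prod[of k n] assms by (simp add: mult.assoc)
  then show ?thesis using B_pos[of "n * p - Suc k"] by simp
qed

text \<open>Unrolls the last \<open>m\<close> steps of \<open>n\<close> periods. Counted back from
  the end, the weights do not depend on \<open>n\<close>, which makes the later bounds uniform in
  \<open>n\<close>.\<close>

lemma beta_rem_tail:
  assumes "m \<le> n * p"
  shows "beta_rem b x (n * p) = beta_rem b x (n * p - m) * tail_prod m
    - (\<Sum>j<m. of_int (beta_digit b x (n * p - Suc j)) * tail_prod j)"
  using assms
proof (induction m)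
  case (Suc m)
  define k where "k = n * p - Suc m"
  have k: "n * p - m = Suc k" using Suc.prems by (simp add: k_def)
  have "beta_rem b x (Suc k) * tail_prod m
      = beta_rem b x k * (b k * tail_prod m) - of_int (beta_digit b x k) * tail_prod m"
    unfolding beta_rem_Suc_digit by (simp add: algebra_simps)
  also have "b k * tail_prod m = tail_prod (Suc m)" using tail_prod_Suc[OF Suc.prems] by (simp add: k_def)
  finally show ?case using Suc.IH Suc.prems unfolding k by (simp add: k_def del: beta_rem.simps)
qed simp

lemma finite_termination_bound:
  assumes "finite E"
  shows "\<exists>T. \<forall>f\<in>E \<inter> Fin b. beta_rem b f (T * p) = 0"
  using assms
proof (induction E)
  case (insert f E)
  then obtain T where T: "\<forall>f\<in>E \<inter> Fin b. beta_rem b f (T * p) = 0" by blast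
  obtain N where N: "f \<in> Fin b \<Longrightarrow> beta_rem b f N = 0" using in_Fin_iff by blast
  have "N * 1 \<le> N * p" using p_pos by (intro mult_le_mono) auto
  then have "T * p \<le> (T + N) * p" "N \<le> (T + N) * p" unfolding add_mult_distrib by linarith+
  then have "\<forall>g\<in>insert f E \<inter> Fin b. beta_rem b g ((T + N) * p) = 0"
    using T N beta_rem_stays_0 by blast
  then show ?case by blast
qed simp

end

lemma finite_uniform_bound:
  fixes f :: "'a \<Rightarrow> 'b \<Rightarrow> real"
  assumes "finite Z" "\<And>z. z \<in> Z \<Longrightarrow> \<exists>H. \<forall>n. f z n \<le> H"
  shows "\<exists>H\<ge>0. \<forall>z\<in>Z. \<forall>n. f z n \<le> H"
  using assms
proof (induction Z)
  case (insert z Z)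
  then obtain H H' where "H \<ge> 0" "\<forall>z\<in>Z. \<forall>n. f z n \<le> H" "\<forall>n. f z n \<le> H'" by (meson insertI1 insertI2)
  then show ?case by (intro exI[of _ "max H H'"]) (auto simp: le_max_iff_disj)
qed auto

lemma finite_positive_gap:
  fixes E :: "real set"
  assumes "finite E"
  shows "\<exists>\<gamma>>0. \<forall>v\<in>E. v > 0 \<longrightarrow> \<gamma> \<le> v"
  using assms
proof (induction E)
  case (insert v E)
  then obtain \<gamma> where "\<gamma> > 0" "\<forall>v\<in>E. v > 0 \<longrightarrow> \<gamma> \<le> v" by blast
  then show ?case by (intro exI[of _ "if v > 0 then min v \<gamma> else \<gamma>"]) auto
qed (auto intro: exI[of _ 1])

section \<open>Finiteness of elements with bounded conjugates\<close>

locale pisot_finitary_base = finitary_base +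
  fixes q :: "int poly"
  assumes monic: "lead_coeff q = 1" and irr: "irreducible q" and root: "ipoly q \<delta> = 0"
    and unit: "coeff q 0 = 1 \<or> coeff q 0 = -1"
    and pisot: "\<And>z::complex. ipoly q z = 0 \<Longrightarrow> z \<noteq> of_real \<delta> \<Longrightarrow> cmod z < 1"
begin

lemma degree_pos: "degree q > 0"
proof (rule ccontr)
  assume "\<not> degree q > 0"
  then obtain a where "q = [:a:]" by (auto elim: degree_eq_zeroE)
  then show False using monic root by (simp add: ipoly_simps)
qed

lemma root_complex: "ipoly q (complex_of_real \<delta>) = 0"
  using root by (simp add: ipoly_of_real)

definition conjugates :: "complex set" where
  "conjugates = {z. ipoly q z = 0 \<and> z \<noteq> of_real \<delta>}"

lemma finite_conjugates: "finite conjugates"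
proof -
  have "map_poly of_int q \<noteq> (0 :: complex poly)"
    using degree_pos degree_map_poly_of_int[of q, where 'a=complex] by auto
  then have "finite {z::complex. ipoly q z = 0}" by (rule poly_roots_finite)
  then show ?thesis by (rule rev_finite_subset) (auto simp: conjugates_def)
qed

text \<open>Elements of a fractional ideal with denominator \<open>D\<close>, of bounded conjugates.
  Taking the numerator as an integer polynomial gives its conjugates as values at the other roots,
  without field embeddings.\<close>

definition bounded_elements :: "int poly \<Rightarrow> real \<Rightarrow> real set" where
  "bounded_elements D C = {f. \<bar>f\<bar> \<le> 1 \<and>
     (\<exists>P. ipoly P \<delta> = ipoly D \<delta> * f \<and> (\<forall>z\<in>conjugates. cmod (ipoly P z) \<le> C))}"

text \<open>Reducing the numerator modulo \<open>q\<close> changes no value at a root of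
  \<open>q\<close>. At \<delta> the value is bounded because \<open>f\<close> is, so finitely many
  remainders are possible.\<close>

lemma finite_bounded_elements:
  assumes D: "ipoly D \<delta> \<noteq> 0"
  shows "finite (bounded_elements D C)"
proof -
  define M where "M = max C \<bar>ipoly D \<delta>\<bar>"
  let ?R = "{P :: int poly. degree P < degree q \<and>
    (\<forall>z::complex. ipoly q z = 0 \<longrightarrow> cmod (ipoly P z) \<le> M)}"
  have "bounded_elements D C \<subseteq> (\<lambda>P. ipoly P \<delta> / ipoly D \<delta>) ` ?R"
  proof
    fix f assume "f \<in> bounded_elements D C"
    then obtain P where f: "\<bar>f\<bar> \<le> 1" and P: "ipoly P \<delta> = ipoly D \<delta> * f"
        "\<forall>z\<in>conjugates. cmod (ipoly P z) \<le> C"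
      by (auto simp: bounded_elements_def)
    obtain S R where SR: "P = q * S + R" "degree R < degree q"
      using monic_division[OF monic degree_pos] by blast
    have eq: "ipoly R z = ipoly P z" if "ipoly q z = 0" for z :: complex
      using that by (simp add: SR(1) ipoly_simps)
    have R\<delta>: "ipoly R \<delta> = ipoly D \<delta> * f" using P(1) root by (simp add: SR(1) ipoly_simps)
    have "cmod (ipoly R z) \<le> M" if z: "ipoly q z = 0" for z :: complex
    proof (cases "z = of_real \<delta>")
      case True
      have "\<bar>ipoly D \<delta> * f\<bar> \<le> \<bar>ipoly D \<delta>\<bar> * 1" unfolding abs_mult using f by (intro mult_left_mono) auto
      then show ?thesis using True by (simp add: ipoly_of_real R\<delta> M_def norm_mult abs_mult)
    next
      case False
      then show ?thesis using P(2) z eq by (auto simp: conjugates_def M_def le_max_iff_disj)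
    qed
    then show "f \<in> (\<lambda>P. ipoly P \<delta> / ipoly D \<delta>) ` ?R"
      using SR(2) R\<delta> D by (intro image_eqI[of _ _ R]) auto
  qed
  then show ?thesis
    by (rule finite_subset) (intro finite_imageI finite_int_polys_bounded_at_roots irr degree_pos)
qed

lemma common_denominator:
  "\<exists>D. ipoly D \<delta> \<noteq> 0 \<and> (\<forall>j\<in>{1..n}. \<exists>P. ipoly P \<delta> = ipoly D \<delta> / B j)"
proof (induction n)
  case 0
  show ?case by (intro exI[of _ 1]) simp
next
  case (Suc n)
  then obtain D where D: "ipoly D \<delta> \<noteq> 0" "\<forall>j\<in>{1..n}. \<exists>P. ipoly P \<delta> = ipoly D \<delta> / B j" by blast
  obtain P' D' where D': "ipoly D' \<delta> \<noteq> 0" "1 / B (Suc n) = ipoly P' \<delta> / ipoly D' \<delta>"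
    using inverse_B_in_field[of "Suc n"] by blast
  have "\<exists>P. ipoly P \<delta> = ipoly (D * D') \<delta> / B j" if "j \<in> {1..Suc n}" for j
  proof (cases "j = Suc n")
    case True
    have "ipoly (D * P') \<delta> = ipoly D \<delta> * ipoly D' \<delta> * (1 / B (Suc n))"
      using D' by (simp add: ipoly_simps)
    then show ?thesis using True by (intro exI[of _ "D * P'"]) (simp add: ipoly_simps)
  next
    case False
    then have "j \<in> {1..n}" using that by auto
    then obtain P where "ipoly P \<delta> = ipoly D \<delta> / B j" using D(2) by blast
    then show ?thesis by (intro exI[of _ "P * D'"]) (simp add: ipoly_simps)
  qed
  then show ?case using D D' by (intro exI[of _ "D * D'"]) (auto simp: ipoly_simps)
qed

text \<open>\<open>tail_prod\<close> gains a factor \<delta> per period, so the \<open>p\<close>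
  denominators of one period suffice. The recurrence is stated at every \<open>z\<close> to give
  geometric decay at the conjugates.\<close>

lemma tail_prod_polys:
  obtains D c where "ipoly D \<delta> \<noteq> 0" "\<And>k. ipoly (c k) \<delta> = ipoly D \<delta> * tail_prod k"
    "\<And>k z::complex. ipoly (c (k + p)) z = z * ipoly (c k) z"
proof -
  obtain D where D: "ipoly D \<delta> \<noteq> 0" "\<forall>j\<in>{1..p}. \<exists>P. ipoly P \<delta> = ipoly D \<delta> / B j"
    using common_denominator by blast
  have "p - k mod p \<in> {1..p}" for k
    using mod_less_divisor[OF p_pos, of k] by simp
  then have "\<forall>k. \<exists>P. ipoly P \<delta> = ipoly D \<delta> / B (p - k mod p)" using D(2) by blast
  then obtain P where P: "\<And>k. ipoly (P k) \<delta> = ipoly D \<delta> / B (p - k mod p)" by metis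
  show thesis
  proof (rule that[of D "\<lambda>k. [:0, 1:] ^ Suc (k div p) * P (k mod p)"])
    show "ipoly ([:0, 1:] ^ Suc (k div p) * P (k mod p)) \<delta> = ipoly D \<delta> * tail_prod k" for k
      using P[of "k mod p"] by (simp add: ipoly_mult ipoly_power ipoly_X tail_prod_def del: power_Suc) simp
    show "ipoly ([:0, 1:] ^ Suc ((k + p) div p) * P ((k + p) mod p)) z
        = z * ipoly ([:0, 1:] ^ Suc (k div p) * P (k mod p)) z" for k and z :: complex
      using p_pos by (simp add: ipoly_mult ipoly_power ipoly_X del: power_Suc) simp
  qed (rule D)
qed

section \<open>Pure periodicity of small rationals\<close>

lemma property_PP_base: "property_PP b"
proof -
  obtain D c where D: "ipoly D \<delta> \<noteq> 0" and c: "\<And>k. ipoly (c k) \<delta> = ipoly D \<delta> * tail_prod k"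
    and c_period: "\<And>k z::complex. ipoly (c (k + p)) z = z * ipoly (c k) z"
    using tail_prod_polys by blast
  obtain U where U: "\<And>z::complex. ipoly q z = 0 \<Longrightarrow> z * ipoly U z = 1"
    using inverse_mod_unit_poly[OF unit] by blast
  have "complex_of_real (\<delta> * ipoly U \<delta>) = of_real 1"
    using U[OF root_complex] by (simp add: ipoly_of_real)
  then have "\<delta> * ipoly U \<delta> = 1" by (simp only: of_real_eq_iff)
  then have U\<delta>: "ipoly U \<delta> = 1 / \<delta>" using \<delta>_gt_1 by (simp add: field_simps)
  obtain A where A: "\<And>k. b k \<le> A" using b_bounded by blast
  then have A0: "A \<ge> 0" using b_gt_1[of 0] A[of 0] by linarith
  have "\<exists>H\<ge>0. \<forall>z\<in>conjugates. \<forall>N. (\<Sum>k<N. norm (ipoly (c k) z)) \<le> H"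
  proof (rule finite_uniform_bound[OF finite_conjugates])
    fix z assume "z \<in> conjugates"
    then have "cmod z < 1" using pisot by (auto simp: conjugates_def)
    then show "\<exists>H. \<forall>N. (\<Sum>k<N. norm (ipoly (c k) z)) \<le> H"
      by (intro periodic_decay_bounded_sums[where \<rho> = "cmod z" and p = p])
         (auto simp: c_period norm_mult)
  qed
  then obtain H where H0: "H \<ge> 0" and H: "\<And>z N. z \<in> conjugates \<Longrightarrow> (\<Sum>k<N. norm (ipoly (c k) z)) \<le> H"
    by blast
  \<comment> \<open>One constant for two families: \<open>1 + A * H\<close> bounds the conjugates
    for the remainder \<open>f\<close>, and \<open>H + A * H\<close> those for the gaps
    \<open>v\<close>.\<close>
  define C where "C = 1 + A * H + H"
  define E where "E = bounded_elements D C"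
  have finE: "finite E" unfolding E_def using D by (rule finite_bounded_elements)
  \<comment> \<open>\<open>E\<close> involves neither \<open>T\<close> nor any rational
    \<open>x\<close>, so \<open>T\<close> can be chosen from \<open>E\<close>, and \<gamma>
    afterwards from \<open>T\<close>.\<close>
  obtain T where T: "\<And>f. f \<in> E \<Longrightarrow> f \<in> Fin b \<Longrightarrow> beta_rem b f (T * p) = 0"
    using finite_termination_bound[OF finE] by blast
  obtain \<gamma>0 where \<gamma>0: "\<gamma>0 > 0" "\<And>v. v \<in> E \<Longrightarrow> v > 0 \<Longrightarrow> \<gamma>0 \<le> v"
    using finite_positive_gap[OF finE] by blast
  \<comment> \<open>At a conjugate \<open>U\<close> has the value \<open>1 / z\<close>, of modulus
    above 1; \<open>G\<close> measures this loss. The index of type \<open>unit\<close> is a dummy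
    that fits \<open>finite_uniform_bound\<close> to one number per conjugate.\<close>
  have "\<exists>G\<ge>0. \<forall>z\<in>conjugates. \<forall>u::unit. cmod (ipoly D z) * cmod (ipoly U z) ^ T \<le> G"
    by (rule finite_uniform_bound[OF finite_conjugates]) auto
  then obtain G where G0: "G \<ge> 0"
    and G: "\<And>z. z \<in> conjugates \<Longrightarrow> cmod (ipoly D z) * cmod (ipoly U z) ^ T \<le> G" by auto
  \<comment> \<open>The bound \<gamma>0 is for the gaps below 1; the last term makes the conjugates
    coming from \<open>x\<close> at most 1, with \<open>G + 1\<close> to avoid division by
    0.\<close>
  define \<gamma> where "\<gamma> = min (min \<gamma>0 1) (1 / (2 * (G + 1)))"
  have \<gamma>: "\<gamma> > 0" "\<gamma> \<le> \<gamma>0" "\<gamma> \<le> 1" "2 * \<gamma> * G \<le> 1"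
  proof -
    have "\<gamma> * (2 * (G + 1)) \<le> 1"
      using G0 by (simp add: \<gamma>_def min_def field_simps)
    moreover show "\<gamma> > 0" "\<gamma> \<le> \<gamma>0" "\<gamma> \<le> 1" using G0 \<gamma>0 by (auto simp: \<gamma>_def)
    ultimately show "2 * \<gamma> * G \<le> 1" by (simp add: algebra_simps)
  qed
  have "purely_periodic (beta_digit b x)" if x: "x \<in> \<rat>" "0 \<le> x" "x < \<gamma>" for x
  proof -
    obtain r s where rs: "s > 0" "x = of_int r / of_int s" using Rats_cases'[OF x(1)] by metis
    obtain n S where n: "n > 0"
      and S: "\<And>z::complex. ipoly q z = 0 \<Longrightarrow> of_int s * ipoly S z = z ^ n - 1"
      using power_eq_one_mod[OF monic degree_pos unit rs(1)] by blast
    define P where "P = smult r S"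
    have P: "ipoly P z = of_real x * (z ^ n - 1)" if "ipoly q z = 0" for z :: complex
      using S[OF that, symmetric] rs by (simp add: P_def ipoly_simps)
    have "complex_of_real (ipoly P \<delta>) = of_real (x * (\<delta> ^ n - 1))"
      using P[OF root_complex] by (simp add: ipoly_of_real)
    then have P\<delta>: "ipoly P \<delta> = x * (\<delta> ^ n - 1)" by (simp only: of_real_eq_iff)
    define y where "y = x * (1 - 1 / \<delta> ^ n)"
    have \<delta>n: "\<delta> ^ n > 1" using \<delta>_gt_1 n by simp
    have "y \<le> x * 1" unfolding y_def using x \<delta>n by (intro mult_left_mono) auto
    moreover have y0: "0 \<le> y" unfolding y_def using x \<delta>n by (intro mult_nonneg_nonneg) auto
    ultimately have y1: "y < 1" using x \<gamma> by linarith
    have y_\<delta>n: "y * \<delta> ^ n = x * (\<delta> ^ n - 1)" using \<delta>_gt_1 by (simp add: y_def field_simps)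
    have "y = ipoly (P * U ^ n) \<delta>"
      using \<delta>_gt_1 by (simp add: y_def ipoly_mult ipoly_power P\<delta> U\<delta> field_simps)
    then have yFin: "y \<in> Fin b" using Fin_module_in_Fin[OF ipoly_in_Fin_module] y0 y1 by simp
    define y' where "y' = y / \<delta> ^ T"
    have y'Fin: "y' \<in> Fin b" unfolding y'_def using yFin divide_power_in_Fin_iff y0 y1 by simp
    have y': "0 \<le> y'" "y' < 1" using y'Fin Fin_bounds by auto
    have digit_bound: "\<bar>real_of_int (beta_digit b t k)\<bar> \<le> A" if "0 \<le> t" "t < 1" for t k
      using beta_digit_bounds[OF that, of k] A[of k] by auto
    \<comment> \<open>The numerator over \<open>D\<close> of the digit sum in
      \<open>beta_rem_tail\<close>.\<close>
    define w where "w = (\<lambda>t m. \<Sum>j<m. smult (beta_digit b t (n * p - Suc j)) (c j))"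
    have w\<delta>: "ipoly (w t m) \<delta> = ipoly D \<delta> * (\<Sum>j<m. of_int (beta_digit b t (n * p - Suc j)) * tail_prod j)"
      for t m by (simp add: w_def ipoly_sum ipoly_smult c sum_distrib_left mult_ac)
    have w_bound: "cmod (ipoly (w t m) z) \<le> A * H" if "0 \<le> t" "t < 1" "z \<in> conjugates" for t m z
      unfolding w_def ipoly_sum ipoly_smult
      by (rule norm_weighted_sum_le) (use that digit_bound H A0 in auto)
    define f where "f = beta_rem b y' (n * p)"
    have fFin: "f \<in> Fin b" unfolding f_def using y'Fin by (rule beta_rem_in_Fin)
    have "f \<in> E"
      unfolding E_def bounded_elements_def
    proof (intro CollectI conjI exI[of _ "D * P * U ^ T - w y' (n * p)"] ballI)
      show "\<bar>f\<bar> \<le> 1" using Fin_bounds[OF fFin] by auto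
      have "f = y' * \<delta> ^ n - (\<Sum>j<n * p. of_int (beta_digit b y' (n * p - Suc j)) * tail_prod j)"
        unfolding f_def using beta_rem_tail[of "n * p" n y'] by (simp add: tail_prod_period)
      \<comment> \<open>This term is the value of \<open>P * U ^ T\<close> at \<delta>, which
        explains the first part of the witness.\<close>
      moreover have "y' * \<delta> ^ n = x * (\<delta> ^ n - 1) * (1 / \<delta>) ^ T"
        using y_\<delta>n by (simp add: y'_def power_one_over)
      ultimately show "ipoly (D * P * U ^ T - w y' (n * p)) \<delta> = ipoly D \<delta> * f"
        by (simp only: ipoly_diff ipoly_mult ipoly_power w\<delta> P\<delta> U\<delta> right_diff_distrib mult.assoc)
    next
      fix z assume z: "z \<in> conjugates"
      then have qz: "ipoly q z = 0" and z1: "cmod z < 1" using pisot by (auto simp: conjugates_def)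
      \<comment> \<open>Being rational, \<open>x\<close> is its own conjugate: \<open>P\<close>
        takes the value \<open>x * (z ^ n - 1)\<close> at \<open>z\<close>, and \<open>x\<close> is
        below \<gamma>.\<close>
      have "cmod (z ^ n - 1) \<le> cmod z ^ n + 1" using norm_triangle_ineq4[of "z ^ n" 1] by (simp add: norm_power)
      also have "\<dots> \<le> 2" using z1 power_le_one[of "cmod z" n] by simp
      finally have "cmod (ipoly P z) \<le> \<gamma> * 2"
        unfolding P[OF qz] norm_mult using x by (intro mult_mono) auto
      then have "cmod (ipoly (D * P * U ^ T) z) \<le> 2 * \<gamma> * G"
        using mult_mono[OF _ G[OF z], of "cmod (ipoly P z)" "\<gamma> * 2"] \<gamma>(1)
        by (simp add: ipoly_mult ipoly_power norm_mult norm_power mult_ac)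
      then show "cmod (ipoly (D * P * U ^ T - w y' (n * p)) z) \<le> C"
        using w_bound[OF y' z, of "n * p"] \<gamma>(4) H0
          norm_triangle_ineq4[of "ipoly (D * P * U ^ T) z" "ipoly (w y' (n * p)) z"]
        by (simp add: ipoly_diff C_def)
    qed
    then have "beta_rem b f (T * p) = 0" using T fFin by blast
    moreover have "beta_rem b y' (T * p) = y"
      unfolding y'_def using beta_rem_divide[OF y0 y1, of "T * p" "T * p"] \<delta>_gt_1
      by (simp add: B_power)
    \<comment> \<open>On \<open>y'\<close>, running \<open>n\<close> periods and then
      \<open>T\<close> equals running \<open>T\<close>, which returns to \<open>y\<close>, and then
      \<open>n\<close>.\<close>
    then have "beta_rem b f (T * p) = beta_rem b y (n * p)"
      unfolding f_def by (metis beta_rem_period add.commute)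
    ultimately have y_end: "beta_rem b y (n * p) = 0" by simp
    have room: "beta_rem b y k + x * B k / \<delta> ^ n < 1" if k: "k \<le> n * p" for k
    proof -
      define m where "m = n * p - k"
      \<comment> \<open>The gap below 1 at step \<open>k\<close>, scaled to the end of the block,
        where the claim becomes \<open>v > x\<close>. Since the last remainder of \<open>y\<close>
        is 0, \<open>v\<close> is a tail product minus a digit sum, so it lies in \<open>E\<close>
        unless it exceeds 1.\<close>
      define v where "v = (1 - beta_rem b y k) * tail_prod m"
      have m: "m \<le> n * p" "n * p - m = k" using k by (auto simp: m_def)
      have v_pos: "v > 0" unfolding v_def using beta_rem_bounds[OF y0 y1, of b k] tail_prod_pos[of m] by simp
      have v: "v = tail_prod m - (\<Sum>j<m. of_int (beta_digit b y (n * p - Suc j)) * tail_prod j)"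
        using beta_rem_tail[OF m(1), of y] y_end m(2) by (simp add: v_def algebra_simps)
      have v_gt: "v > x"
      proof (cases "v \<le> 1")
        case True
        have "v \<in> E"
          unfolding E_def bounded_elements_def
        proof (intro CollectI conjI exI[of _ "c m - w y m"] ballI)
          show "ipoly (c m - w y m) \<delta> = ipoly D \<delta> * v"
            by (simp only: ipoly_diff c w\<delta> v right_diff_distrib)
        next
          fix z assume z: "z \<in> conjugates"
          have "cmod (ipoly (c m) z) \<le> (\<Sum>k<Suc m. norm (ipoly (c k) z))"
            by (rule member_le_sum) auto
          then have "cmod (ipoly (c m) z) \<le> H" using H[OF z, of "Suc m"] by linarith
          then show "cmod (ipoly (c m - w y m) z) \<le> C"
            using w_bound[OF y0 y1 z, of m] norm_triangle_ineq4[of "ipoly (c m) z" "ipoly (w y m) z"]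
            by (simp add: ipoly_diff C_def)
        qed (use True v_pos in auto)
        then show ?thesis using \<gamma>0(2) v_pos x \<gamma>(2) by fastforce
      qed (use x \<gamma> in auto)
      have "B k * tail_prod m = \<delta> ^ n" using B_tail_prod[OF m(1)] m(2) by simp
      then have "x * B k / \<delta> ^ n = x / tail_prod m"
        using tail_prod_pos[of m] \<delta>_gt_1 by (auto simp: field_simps)
      also have "\<dots> < 1 - beta_rem b y k"
        using v_gt tail_prod_pos[of m] by (simp add: v_def divide_less_eq)
      finally show ?thesis by simp
    qed
    \<comment> \<open>By \<open>room\<close>, adding the share of \<open>x / \<delta> ^ n\<close>
      never causes a carry, so \<open>x\<close> and \<open>y\<close> have the same first
      \<open>n * p\<close> digits. At the end of the block the remainder is \<open>x\<close>
      again.\<close>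
    have "beta_rem b x k = beta_rem b y k + x * B k / \<delta> ^ n" if "k \<le> n * p" for k
      using that
    proof (induction k)
      case 0
      then show ?case using \<delta>_gt_1 by (simp add: y_def field_simps)
    next
      case (Suc k)
      define t where "t = beta_rem b y (Suc k) + x * B (Suc k) / \<delta> ^ n"
      have t: "0 \<le> t" "t < 1"
        using beta_rem_bounds(1)[OF y0 y1, of b "Suc k"] x B_pos[of "Suc k"] \<delta>n room[OF Suc.prems]
        by (simp_all add: t_def del: beta_rem.simps)
      have "b k * beta_rem b x k = b k * beta_rem b y k + x * B (Suc k) / \<delta> ^ n"
        using Suc by (simp add: base_prod_Suc algebra_simps)
      also have "\<dots> = of_int (beta_digit b y k) + t"
        unfolding t_def beta_rem_Suc_digit by simp
      finally have eq: "b k * beta_rem b x k = of_int (beta_digit b y k) + t" .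
      then have "\<lfloor>b k * beta_rem b x k\<rfloor> = beta_digit b y k" using t by (simp add: floor_eq_iff)
      then have "beta_rem b x (Suc k) = t" using eq by simp
      then show ?case by (simp only: t_def)
    qed
    from this[of "n * p"] have "beta_rem b x (n * p) = x" using y_end \<delta>_gt_1 by (simp add: B_power)
    then have "beta_digit b x (k + n * p) = beta_digit b x k" for k
      using beta_digit_period[of x n k] by (simp add: add.commute)
    then show ?thesis unfolding purely_periodic_def using n p_pos by (intro exI[of _ "n * p"]) auto
  qed
  then show ?thesis unfolding property_PP_def using \<gamma>(1) by blast
qed

end

section \<open>Passage to the shifted bases\<close>

theorem theoremC:
  fixes p :: nat and b :: "nat \<Rightarrow> real"
  assumes "alt_base p b"
    and "property_F b"
    and "pisot_unit (\<Prod>k<p. b k)"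
  shows "\<forall>i<p. property_PP (\<lambda>k. b (k + i))"
proof (intro allI impI)
  fix i assume "i < p"
  interpret alternate_base p b by unfold_locales (rule assms)
  interpret sh: alternate_base p "\<lambda>k. b (k + i)" by (rule alternate_base_shift)
  \<comment> \<open>The product of the first \<open>i + p\<close> entries is split in two ways, so
    every shift has the same \<delta>.\<close>
  have "B i * sh.\<delta> = B i * \<delta>"
    using base_prod_add[of b i p] B_period[of i 1] by (simp add: sh.\<delta>_def)
  then have "sh.\<delta> = (\<Prod>k<p. b k)" using B_pos[of i] by (simp add: \<delta>_def base_prod_def[of b p])
  with assms(3) obtain q :: "int poly" where "lead_coeff q = 1" "irreducible q" "ipoly q sh.\<delta> = 0"
      "coeff q 0 = 1 \<or> coeff q 0 = -1"
      "\<And>z::complex. ipoly q z = 0 \<Longrightarrow> z \<noteq> of_real sh.\<delta> \<Longrightarrow> cmod z < 1"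
    unfolding pisot_unit_def by metis
  then interpret sh: pisot_finitary_base p "\<lambda>k. b (k + i)" q
    by unfold_locales (use property_F_shift[OF assms(2)] in auto)
  show "property_PP (\<lambda>k. b (k + i))" by (rule sh.property_PP_base)
qed

end
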